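(* Let $i\ge 0$ be an integer and let $p:\mathbb{N}\to[0,1]$, $n\mapsto p_n$, be middling of exponent $2i$. Then $$\lim_{n\to\infty}\ \mathbb{P}_{\Gamma\in\Omega^{[n]}_{p_n}}\Big(\kappa^i_{\mathbb{F}_2}(\Gamma)\le\delta^i(\Gamma)\Big)=1 .$$
   Context: Graphs are finite and simple, $\Gamma=(V(\Gamma),E(\Gamma))$. $\mathbb{N}=\{1,2,\dots\}$ and $[n]=\{1,\dots,n\}$. $\Omega^{[n]}_{p}$ denotes the Erdős–Rényi probability space of random graphs on vertex set $[n]$ in which each of the $\binom n2$ possible edges is present independently with probability $p$. A function $p:\mathbb{N}\to[0,1]$ is middling of exponent $w$ if $-\liminf_{n\to\infty}\log_n p_n<w^{-1}$ and $\lim_{n\to\infty}p_n=0$. (For $w=0$ read $w^{-1}=+\infty$.) For $C\subseteq V(\Gamma)$, $\Gamma-C$ is the subgraph of $\Gamma$ induced on $V(\Gamma)\setminus C$. For a vertex $v$, $N_\Gamma(v)=\{u:\{u,v\}\in E(\Gamma)\}$, and for a vertex set $I$, $N_\Gamma(I)=\bigcap_{c\in I}N_\Gamma(c)$ is the set of common neighbors. $\mathrm{Cl}(\Gamma)$ is the clique complex of $\Gamma$: the simplicial complex on $V(\Gamma)$ whose set of $i$-simplices $\mathrm{Cl}(\Gamma)[i]$ consists of the $(i+1)$-element vertex subsets that are pairwise adjacent. For a field $\mathbb{K}$ and an integer $i\ge 0$, $$\kappa^i_{\mathbb{K}}(\Gamma)=\min\{|C| : C\subseteq V(\Gamma),\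 \tilde H^i(\mathrm{Cl}(\Gamma-C);\mathbb{K})\ne 0\},$$ $$\delta^i(\Gamma)=\min\{|N_\Gamma(I)| : I\in \mathrm{Cl}(\Gamma)[i]\},$$ where $\tilde H^i$ is reduced simplicial cohomology and the minimum over the empty set is $+\infty$. $\mathbb{F}_2$ is the field with two elements. *)

theory Defs
  imports
    "HOL-Probability.Probability"
    "HOL-Library.Z2"
    "HOL-Library.Extended_Nat"
    "HOL-Algebra.Elementary_Groups"
begin

section \<open>Finite simple graphs\<close>

record 'a sgraph =
  verts :: "'a set"
  edges :: "'a set set"

definition simple_graph :: "'a sgraph \<Rightarrow> bool" where
  "simple_graph G \<longleftrightarrow>
     finite (verts G) \<and> (\<forall>e\<in>edges G. e \<subseteq> verts G \<and> card e = 2)"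

definition delete_verts :: "'a sgraph \<Rightarrow> 'a set \<Rightarrow> 'a sgraph" where
  "delete_verts G C =
     \<lparr>verts = verts G - C, edges = {e \<in> edges G. e \<subseteq> verts G - C}\<rparr>"

definition nbhd :: "'a sgraph \<Rightarrow> 'a \<Rightarrow> 'a set" where
  "nbhd G v = {u. {u, v} \<in> edges G}"

definition common_nbhd :: "'a sgraph \<Rightarrow> 'a set \<Rightarrow> 'a set" where
  "common_nbhd G I = (\<Inter>c\<in>I. nbhd G c)"

section \<open>Clique complexes and reduced simplicial cohomology\<close>

text \<open>A simplicial complex is given by the set of its faces, including the empty face, which is the
  unique simplex of dimension \<open>-1\<close>. Hence dimensions are integers, and the cochain complex
  below is the augmented one.\<close>

definition clique_complex :: "'a sgraph \<Rightarrow> 'a set set" where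
  "clique_complex G =
     {\<sigma>. finite \<sigma> \<and> \<sigma> \<subseteq> verts G \<and> (\<forall>u\<in>\<sigma>. \<forall>v\<in>\<sigma>. u \<noteq> v \<longrightarrow> {u, v} \<in> edges G)}"

definition simplices :: "'a set set \<Rightarrow> int \<Rightarrow> 'a set set" where
  "simplices X i = {\<sigma> \<in> X. finite \<sigma> \<and> int (card \<sigma>) = i + 1}"

text \<open>A cochain is a function on all vertex sets that is zero off the simplices of its dimension.\<close>

definition cochains :: "'a set set \<Rightarrow> int \<Rightarrow> ('a set \<Rightarrow> 'k::field) set" where
  "cochains X i = {f. \<forall>\<sigma>. \<sigma> \<notin> simplices X i \<longrightarrow> f \<sigma> = 0}"

text \<open>Simplices are oriented by the order of the vertices: if \<open>v\<close> is the vertex of \<open>\<sigma>\<close> at position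
  \<open>j\<close>, counting from \<open>0\<close>, then the face \<open>\<sigma> - {v}\<close> has sign \<open>(-1) ^ j\<close>.\<close>

definition coboundary ::
  "'a::linorder set set \<Rightarrow> int \<Rightarrow> ('a set \<Rightarrow> 'k::field) \<Rightarrow> ('a set \<Rightarrow> 'k)" where
  "coboundary X i f = (\<lambda>\<sigma>. if \<sigma> \<in> simplices X (i + 1)
     then \<Sum>v\<in>\<sigma>. (- 1) ^ card {u \<in> \<sigma>. u < v} * f (\<sigma> - {v}) else 0)"

definition cocycles :: "'a::linorder set set \<Rightarrow> int \<Rightarrow> ('a set \<Rightarrow> 'k::field) set" where
  "cocycles X i = {f \<in> cochains X i. coboundary X i f = (\<lambda>_. 0)}"

definition coboundaries :: "'a::linorder set set \<Rightarrow> int \<Rightarrow> ('a set \<Rightarrow> 'k::field) set" where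
  "coboundaries X i = coboundary X (i - 1) ` cochains X (i - 1)"

definition cocycle_group :: "'a::linorder set set \<Rightarrow> int \<Rightarrow> ('a set \<Rightarrow> 'k::field) monoid" where
  "cocycle_group X i =
     \<lparr>carrier = cocycles X i, monoid.mult = (\<lambda>f g \<sigma>. f \<sigma> + g \<sigma>), one = (\<lambda>_. 0)\<rparr>"

text \<open>This is the additive group of the cohomology vector space. The space is zero iff the group
  is trivial.\<close>

definition reduced_cohomology ::
  "'a::linorder set set \<Rightarrow> int \<Rightarrow> ('a set \<Rightarrow> 'k::field) set monoid" where
  "reduced_cohomology X i = cocycle_group X i Mod coboundaries X i"

subsection \<open>Well-definedness\<close>

lemma clique_complex_down_closed:
  "\<sigma> \<in> clique_complex G \<Longrightarrow> \<tau> \<subseteq> \<sigma> \<Longrightarrow> \<tau> \<in> clique_complex G"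
  by (auto simp: clique_complex_def dest: finite_subset)

lemma coboundary_in_cochains: "coboundary X i f \<in> cochains X (i + 1)"
  by (auto simp: coboundary_def cochains_def)

lemma coboundary_add:
  "coboundary X i (\<lambda>\<sigma>. f \<sigma> + g \<sigma>) = (\<lambda>\<sigma>. coboundary X i f \<sigma> + coboundary X i g \<sigma>)"
  by (auto simp: coboundary_def fun_eq_iff sum.distrib distrib_left)

lemma coboundary_uminus: "coboundary X i (\<lambda>\<sigma>. - f \<sigma>) = (\<lambda>\<sigma>. - coboundary X i f \<sigma>)"
  by (auto simp: coboundary_def fun_eq_iff sum_negf)

lemma coboundary_zero: "coboundary X i (\<lambda>_. 0) = (\<lambda>_. 0)"
  by (auto simp: coboundary_def fun_eq_iff)

lemma coboundary_coboundary:
  fixes X :: "'a::linorder set set" and f :: "'a set \<Rightarrow> 'k::field"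
  assumes down: "\<And>\<sigma> \<tau>. \<sigma> \<in> X \<Longrightarrow> \<tau> \<subseteq> \<sigma> \<Longrightarrow> \<tau> \<in> X"
  shows "coboundary X (i + 1) (coboundary X i f) = (\<lambda>_. 0)"
proof
  fix \<sigma>
  show "coboundary X (i + 1) (coboundary X i f) \<sigma> = 0"
  proof (cases "\<sigma> \<in> simplices X (i + 1 + 1)")
    case False
    then show ?thesis by (simp add: coboundary_def)
  next
    case True
    then have fin: "finite \<sigma>" by (simp add: simplices_def)
    let ?c = "\<lambda>\<sigma> v. card {u \<in> \<sigma>. u < v}"
    have face: "\<sigma> - {v} \<in> simplices X (i + 1)" if "v \<in> \<sigma>" for v
    proof -
      have "int (card (\<sigma> - {v})) = int (card \<sigma>) - 1"
        using fin that card_Suc_Diff1[of \<sigma> v] by simp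
      then show ?thesis using True down[of \<sigma> "\<sigma> - {v}"] by (simp add: simplices_def)
    qed
    define T where "T v w = (- 1 :: 'k) ^ ?c \<sigma> v * ((- 1) ^ ?c (\<sigma> - {v}) w * f (\<sigma> - {v} - {w}))"
      for v w
    have anti: "T w v = - T v w" if vw: "v \<in> \<sigma>" "w \<in> \<sigma>" "v < w" for v w
    proof -
      have 1: "{u \<in> \<sigma> - {w}. u < v} = {u \<in> \<sigma>. u < v}" using vw by auto
      have 2: "{u \<in> \<sigma>. u < w} = insert v {u \<in> \<sigma> - {v}. u < w}" using vw by auto
      have "?c \<sigma> w = Suc (?c (\<sigma> - {v}) w)"
        unfolding 2 using fin by (subst card_insert_disjoint) auto
      moreover have "\<sigma> - {v} - {w} = \<sigma> - {w} - {v}" by auto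
      ultimately show ?thesis unfolding T_def 1 by simp
    qed
    let ?L = "{(v, w). v \<in> \<sigma> \<and> w \<in> \<sigma> \<and> v < w}" and ?R = "{(v, w). v \<in> \<sigma> \<and> w \<in> \<sigma> \<and> w < v}"
    have finLR: "finite ?L" "finite ?R"
      by (rule finite_subset[of _ "\<sigma> \<times> \<sigma>"], use fin in auto)+
    have "coboundary X (i + 1) (coboundary X i f) \<sigma> = (\<Sum>v\<in>\<sigma>. \<Sum>w\<in>\<sigma> - {v}. T v w)"
      using True face by (simp add: coboundary_def T_def sum_distrib_left)
    also have "\<dots> = (\<Sum>(v, w)\<in>(SIGMA v:\<sigma>. \<sigma> - {v}). T v w)"
      using fin by (simp add: sum.Sigma)
    also have "(SIGMA v:\<sigma>. \<sigma> - {v}) = ?L \<union> ?R" by auto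
    also have "(\<Sum>(v, w)\<in>?L \<union> ?R. T v w) = (\<Sum>(v, w)\<in>?L. T v w) + (\<Sum>(v, w)\<in>?R. T v w)"
      using finLR by (intro sum.union_disjoint) auto
    also have "(\<Sum>(v, w)\<in>?R. T v w) = (\<Sum>(v, w)\<in>?L. T w v)"
      by (rule sum.reindex_bij_witness[of _ prod.swap prod.swap]) auto
    also have "\<dots> = (\<Sum>(v, w)\<in>?L. - T v w)"
      by (rule sum.cong) (auto simp: anti)
    also have "\<dots> = - (\<Sum>(v, w)\<in>?L. T v w)"
      by (simp add: case_prod_unfold sum_negf)
    finally show ?thesis by simp
  qed
qed

lemma cocycle_group_comm_group: "comm_group (cocycle_group X i)"
proof (rule comm_groupI, goal_cases)
  case (1 f g)
  then show ?case by (simp add: cocycle_group_def cocycles_def cochains_def coboundary_add)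
next
  case 2
  then show ?case by (simp add: cocycle_group_def cocycles_def cochains_def coboundary_zero)
next
  case (6 f)
  then have "(\<lambda>\<sigma>. - f \<sigma>) \<in> cocycles X i"
    by (simp add: cocycle_group_def cocycles_def cochains_def coboundary_uminus)
  then show ?case by (intro bexI[of _ "\<lambda>\<sigma>. - f \<sigma>"]) (simp_all add: cocycle_group_def)
next
  case (3 f g h)
  show ?case by (simp add: cocycle_group_def add.assoc)
next
  case (4 f g)
  show ?case by (simp add: cocycle_group_def add.commute)
next
  case (5 f)
  show ?case by (simp add: cocycle_group_def)
qed

lemma subgroup_coboundaries:
  fixes X :: "'a::linorder set set"
  assumes down: "\<And>\<sigma> \<tau>. \<sigma> \<in> X \<Longrightarrow> \<tau> \<subseteq> \<sigma> \<Longrightarrow> \<tau> \<in> X"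
  shows "subgroup (coboundaries X i :: ('a set \<Rightarrow> 'k::field) set) (cocycle_group X i)"
proof -
  interpret comm_group "cocycle_group X i :: ('a set \<Rightarrow> 'k) monoid"
    by (rule cocycle_group_comm_group)
  have sub: "coboundaries X i \<subseteq> (cocycles X i :: ('a set \<Rightarrow> 'k) set)"
  proof
    fix f :: "'a set \<Rightarrow> 'k" assume "f \<in> coboundaries X i"
    then obtain g :: "'a set \<Rightarrow> 'k" where "f = coboundary X (i - 1) g"
      by (auto simp: coboundaries_def)
    then show "f \<in> cocycles X i"
      using coboundary_in_cochains[of X "i - 1" g]
        coboundary_coboundary[where X = X and i = "i - 1" and f = g, OF down]
      by (simp add: cocycles_def)
  qed
  have zero: "(\<lambda>_. 0) \<in> (coboundaries X i :: ('a set \<Rightarrow> 'k) set)"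
    unfolding coboundaries_def
    by (rule image_eqI[of _ _ "\<lambda>_. 0"]) (auto simp: coboundary_zero cochains_def)
  have inv: "(\<lambda>\<sigma>. - f \<sigma>) \<in> coboundaries X i" if f: "f \<in> coboundaries X i"
    for f :: "'a set \<Rightarrow> 'k"
  proof -
    obtain g :: "'a set \<Rightarrow> 'k" where "g \<in> cochains X (i - 1)" "f = coboundary X (i - 1) g"
      using f by (auto simp: coboundaries_def)
    then show ?thesis unfolding coboundaries_def
      by (intro image_eqI[of _ _ "\<lambda>\<sigma>. - g \<sigma>"]) (auto simp: coboundary_uminus cochains_def)
  qed
  have add: "(\<lambda>\<sigma>. f \<sigma> + g \<sigma>) \<in> coboundaries X i"
    if fg: "f \<in> coboundaries X i" "g \<in> coboundaries X i" for f g :: "'a set \<Rightarrow> 'k"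
  proof -
    obtain f' g' :: "'a set \<Rightarrow> 'k" where "f' \<in> cochains X (i - 1)" "f = coboundary X (i - 1) f'"
      "g' \<in> cochains X (i - 1)" "g = coboundary X (i - 1) g'"
      using fg by (auto simp: coboundaries_def)
    then show ?thesis unfolding coboundaries_def
      by (intro image_eqI[of _ _ "\<lambda>\<sigma>. f' \<sigma> + g' \<sigma>"]) (auto simp: coboundary_add cochains_def)
  qed
  show ?thesis
  proof (rule subgroupI)
    fix f :: "'a set \<Rightarrow> 'k" assume f: "f \<in> coboundaries X i"
    have "inv\<^bsub>cocycle_group X i\<^esub> f = (\<lambda>\<sigma>. - f \<sigma>)"
      by (rule inv_equality) (use f inv[OF f] sub in \<open>auto simp: cocycle_group_def\<close>)
    then show "inv\<^bsub>cocycle_group X i\<^esub> f \<in> coboundaries X i" using inv[OF f] by simp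
  qed (use sub zero add in \<open>auto simp: cocycle_group_def\<close>)
qed

lemma comm_group_reduced_cohomology:
  assumes "\<And>\<sigma> \<tau>. \<sigma> \<in> X \<Longrightarrow> \<tau> \<subseteq> \<sigma> \<Longrightarrow> \<tau> \<in> X"
  shows "comm_group (reduced_cohomology X i)"
  unfolding reduced_cohomology_def
  using assms
  by (rule comm_group.abelian_FactGroup[OF cocycle_group_comm_group subgroup_coboundaries])

section \<open>The two graph invariants\<close>

text \<open>In \<^typ>\<open>enat\<close> the infimum of a nonempty set is its minimum, and that of the empty set is
  \<open>\<infinity>\<close>.\<close>

definition kappa :: "'k::field itself \<Rightarrow> nat \<Rightarrow> 'a::linorder sgraph \<Rightarrow> enat" where
  "kappa K i G = (INF C\<in>{C. C \<subseteq> verts G \<and>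
       \<not> trivial_group (reduced_cohomology (clique_complex (delete_verts G C)) (int i)
           :: ('a set \<Rightarrow> 'k) set monoid)}. enat (card C))"

definition delta :: "nat \<Rightarrow> 'a sgraph \<Rightarrow> enat" where
  "delta i G = (INF I\<in>simplices (clique_complex G) (int i). enat (card (common_nbhd G I)))"

section \<open>Random graphs and middling probabilities\<close>

definition all_edges :: "nat \<Rightarrow> nat set set" where
  "all_edges n = {e. e \<subseteq> {1..n} \<and> card e = 2}"

definition erdos_renyi :: "nat \<Rightarrow> real \<Rightarrow> nat sgraph pmf" where
  "erdos_renyi n p =
     map_pmf (\<lambda>present. \<lparr>verts = {1..n}, edges = {e \<in> all_edges n. present e}\<rparr>)
       (Pi_pmf (all_edges n) False (\<lambda>_. bernoulli_pmf p))"

lemma erdos_renyi_simple: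
  "G \<in> set_pmf (erdos_renyi n p) \<Longrightarrow> simple_graph G \<and> verts G = {1..n}"
  unfolding erdos_renyi_def simple_graph_def all_edges_def by fastforce

text \<open>The logarithm of \<open>0\<close> is \<open>-\<infinity>\<close>, unlike the value of the real-valued \<^const>\<open>log\<close> there.\<close>

definition elog :: "real \<Rightarrow> real \<Rightarrow> ereal" where
  "elog b x = (if x = 0 then - \<infinity> else ereal (log b x))"

text \<open>For \<open>w = 0\<close> the bound is \<open>\<infinity>\<close>, since the inverse of \<open>0\<close> in \<^typ>\<open>ereal\<close> is \<open>\<infinity>\<close>.
  The exponent \<open>w\<close> is meant to be nonnegative.\<close>

definition middling :: "real \<Rightarrow> (nat \<Rightarrow> real) \<Rightarrow> bool" where
  "middling w p \<longleftrightarrow>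
     - liminf (\<lambda>n. elog (real n) (p n)) < inverse (ereal w) \<and> p \<longlonglongrightarrow> 0"

end

(*
  A cochain supported on a single i-simplex I is a cocycle of Cl(G - N(I)), since I is a facet
  there.  It is not a coboundary mod 2 as soon as I is a facet of an i-dimensional cross-polytope
  in that complex: summing a coboundary over the 2^(i+1) facets of the cross-polytope gives 0,
  while the indicator of I sums to 1.  The opposite vertices can be chosen greedily if for every
  set A of at most 2i vertices and every v not in A some vertex is adjacent to all of A but not
  to v; the nonadjacency keeps the new vertices outside N(I).  Given A and v, the candidates w
  depend on disjoint sets of edges, so none works with probability at most
  (1 - p^(2i) (1 - p))^(n - 2i - 1).  The middling assumption gives n p^(2i) >= n^b for some b > 0,
  and the resulting bound exp(- n^b / 4) beats the O(n^(2i+1)) pairs (A, v) of the union bound.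
*)
theory Submission
  imports Defs "HOL-Real_Asymp.Real_Asymp"
begin

section \<open>The extension property\<close>

text \<open>Only \<open>w \<noteq> v\<close> is demanded: in a simple graph there are no loops, so
  adjacency to all of \<open>A\<close> already puts \<open>w\<close> outside
  \<open>A\<close>.\<close>

definition common_extension :: "nat \<Rightarrow> 'a sgraph \<Rightarrow> bool" where
  "common_extension k G \<longleftrightarrow>
     (\<forall>A v. A \<subseteq> verts G \<longrightarrow> card A \<le> k \<longrightarrow> v \<in> verts G - A \<longrightarrow>
       (\<exists>w\<in>verts G. w \<noteq> v \<and> {w, v} \<notin> edges G \<and> (\<forall>u\<in>A. {w, u} \<in> edges G)))"

lemma simple_graph_no_loop: "simple_graph G \<Longrightarrow> {v, v} \<notin> edges G"
  by (auto simp: simple_graph_def)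

lemma simple_graph_edge_verts: "simple_graph G \<Longrightarrow> {u, v} \<in> edges G \<Longrightarrow> u \<in> verts G \<and> v \<in> verts G"
  by (auto simp: simple_graph_def)

section \<open>Cross-polytopes and nonzero cohomology mod 2\<close>

text \<open>The facets of the cross-polytope with opposite pairs \<open>v\<close>,
  \<open>w v\<close> are indexed by the set \<open>S\<close> of positions at which the opposite
  vertex is taken. Every ridge lies in exactly two facets, so each value of \<open>g\<close> is
  counted twice and vanishes mod 2.\<close>

lemma sum_coboundary_cross_polytope:
  fixes g :: "'a::linorder set \<Rightarrow> bit"
  assumes fin: "finite I" and inj: "inj_on w I" and disj: "w ` I \<inter> I = {}"
    and facet: "\<And>S. S \<subseteq> I \<Longrightarrow> (I - S) \<union> w ` S \<in> simplices X k"
  shows "(\<Sum>S\<in>Pow I. coboundary X (k - 1) g ((I - S) \<union> w ` S)) = 0"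
proof -
  \<comment> \<open>For \<open>T \<subseteq> I - {v}\<close> this is the ridge that omits the pair
    \<open>v\<close>, \<open>w v\<close> and takes the opposite vertices on
    \<open>T\<close>.\<close>
  define R where "R v T = (I - {v} - T) \<union> w ` T" for v T
  have "coboundary X (k - 1) g ((I - S) \<union> w ` S) = (\<Sum>v\<in>I. g (R v (S - {v})))"
    if S: "S \<subseteq> I" for S
  proof -
    \<comment> \<open>The vertex that the facet of \<open>S\<close> takes from the pair of
      \<open>v\<close>. It lets all facets be summed over the same index set
      \<open>I\<close>.\<close>
    define x where "x v = (if v \<in> S then w v else v)" for v
    have bij: "bij_betw x I ((I - S) \<union> w ` S)"
      unfolding bij_betw_def
    proof
      show "inj_on x I"
        using inj disj S by (fastforce simp: inj_on_def x_def)
      show "x ` I = (I - S) \<union> w ` S"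
        using S by (auto simp: x_def)
    qed
    \<comment> \<open>The orientation signs disappear because \<open>- 1 = 1\<close> in
      \<open>bit\<close>.\<close>
    have "coboundary X (k - 1) g ((I - S) \<union> w ` S) =
        (\<Sum>u\<in>(I - S) \<union> w ` S. g ((I - S) \<union> w ` S - {u}))"
      using facet[OF S] by (simp add: coboundary_def del: mult_bit_eq_and power_bit_unfold)
    also have "\<dots> = (\<Sum>v\<in>I. g ((I - S) \<union> w ` S - {x v}))"
      by (rule sum.reindex_bij_betw[OF bij, symmetric])
    also have "\<dots> = (\<Sum>v\<in>I. g (R v (S - {v})))"
    proof (rule sum.cong[OF refl])
      fix v assume v: "v \<in> I"
      have "(I - S) \<union> w ` S - {x v} = R v (S - {v})"
      proof (cases "v \<in> S")
        case True
        have "w ` S - {w v} = w ` (S - {v})"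
          using inj S True by (auto simp: inj_on_def)
        moreover have "w v \<notin> I" using disj v by auto
        ultimately show ?thesis using True by (auto simp: R_def x_def)
      next
        case False
        then have "v \<notin> w ` S" using disj v S by auto
        then show ?thesis using False by (auto simp: R_def x_def)
      qed
      then show "g ((I - S) \<union> w ` S - {x v}) = g (R v (S - {v}))" by simp
    qed
    finally show ?thesis .
  qed
  then have "(\<Sum>S\<in>Pow I. coboundary X (k - 1) g ((I - S) \<union> w ` S)) =
      (\<Sum>S\<in>Pow I. \<Sum>v\<in>I. g (R v (S - {v})))"
    by simp
  also have "\<dots> = (\<Sum>v\<in>I. \<Sum>S\<in>Pow I. g (R v (S - {v})))"
    by (rule sum.swap)
  also have "\<dots> = 0"
  proof (rule sum.neutral, rule ballI)
    fix v assume v: "v \<in> I"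
    let ?P = "Pow (I - {v})"
    \<comment> \<open>The two facets that share a ridge omitting the pair of \<open>v\<close> are
      those of \<open>S\<close> and \<open>insert v S\<close>.\<close>
    have P: "Pow I = ?P \<union> insert v ` ?P"
      using v Pow_insert[of v "I - {v}"] by (simp add: insert_absorb)
    have "(\<Sum>S\<in>Pow I. g (R v (S - {v}))) =
        (\<Sum>S\<in>?P. g (R v (S - {v}))) + (\<Sum>S\<in>insert v ` ?P. g (R v (S - {v})))"
      unfolding P using fin by (intro sum.union_disjoint) auto
    also have "(\<Sum>S\<in>insert v ` ?P. g (R v (S - {v}))) = (\<Sum>S\<in>?P. g (R v (insert v S - {v})))"
      by (subst sum.reindex) (auto simp: inj_on_def)
    also have "\<dots> = (\<Sum>S\<in>?P. g (R v (S - {v})))"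
      by (rule sum.cong) auto
    finally show "(\<Sum>S\<in>Pow I. g (R v (S - {v}))) = 0" by simp
  qed
  finally show ?thesis .
qed

text \<open>In a trivial quotient the only coset is the subgroup itself, and \<open>f\<close> lies
  in its own coset.\<close>

lemma cocycle_in_coboundaries:
  fixes X :: "'a::linorder set set"
  assumes down: "\<And>\<sigma> \<tau>. \<sigma> \<in> X \<Longrightarrow> \<tau> \<subseteq> \<sigma> \<Longrightarrow> \<tau> \<in> X"
    and triv: "trivial_group (reduced_cohomology X i :: ('a set \<Rightarrow> 'k::field) set monoid)"
    and f: "(f :: 'a set \<Rightarrow> 'k) \<in> cocycles X i"
  shows "f \<in> coboundaries X i"
proof -
  interpret comm_group "cocycle_group X i :: ('a set \<Rightarrow> 'k) monoid"
    by (rule cocycle_group_comm_group)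
  have sub: "subgroup (coboundaries X i) (cocycle_group X i :: ('a set \<Rightarrow> 'k) monoid)"
    by (rule subgroup_coboundaries) (fact down)
  have fc: "f \<in> carrier (cocycle_group X i)"
    using f by (simp add: cocycle_group_def)
  have "coboundaries X i #>\<^bsub>cocycle_group X i\<^esub> f \<in> carrier (reduced_cohomology X i)"
    using rcosetsI[OF subgroup.subset[OF sub] fc] by (simp add: reduced_cohomology_def FactGroup_def)
  then have "coboundaries X i #>\<^bsub>cocycle_group X i\<^esub> f = coboundaries X i"
    using triv by (simp add: trivial_group_def reduced_cohomology_def FactGroup_def)
  with rcos_self[OF fc sub] show ?thesis by simp
qed

text \<open>The nonzero class is that of the indicator of \<open>I\<close>: \<open>maximal\<close>
  makes it a cocycle, and the facets of the cross-polytope detect that it is not a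
  coboundary.\<close>

lemma nontrivial_reduced_cohomology_cross_polytope:
  fixes X :: "'a::linorder set set"
  assumes down: "\<And>\<sigma> \<tau>. \<sigma> \<in> X \<Longrightarrow> \<tau> \<subseteq> \<sigma> \<Longrightarrow> \<tau> \<in> X"
    and fin: "finite I" and inj: "inj_on w I" and disj: "w ` I \<inter> I = {}"
    and facet: "\<And>S. S \<subseteq> I \<Longrightarrow> (I - S) \<union> w ` S \<in> simplices X k"
    and maximal: "\<And>\<sigma>. \<sigma> \<in> X \<Longrightarrow> I \<subseteq> \<sigma> \<Longrightarrow> \<sigma> = I"
  shows "\<not> trivial_group (reduced_cohomology X k :: ('a set \<Rightarrow> bit) set monoid)"
proof
  assume triv: "trivial_group (reduced_cohomology X k :: ('a set \<Rightarrow> bit) set monoid)"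
  define f :: "'a set \<Rightarrow> bit" where "f \<sigma> = of_bool (\<sigma> = I)" for \<sigma>
  have I: "I \<in> simplices X k" using facet[of "{}"] by simp
  have "coboundary X k f \<sigma> = 0" for \<sigma>
  proof (cases "\<sigma> \<in> simplices X (k + 1)")
    case True
    \<comment> \<open>No simplex has \<open>I\<close> as a proper face, so every term of the
      coboundary is zero.\<close>
    have "\<sigma> - {v} \<noteq> I" if "v \<in> \<sigma>" for v
    proof
      assume "\<sigma> - {v} = I"
      with maximal[of \<sigma>] True that show False by (auto simp: simplices_def)
    qed
    then show ?thesis by (simp add: coboundary_def f_def)
  qed (simp add: coboundary_def)
  then have "f \<in> cocycles X k"
    using I by (auto simp: cocycles_def cochains_def f_def)
  then have "f \<in> coboundaries X k"
    by (rule cocycle_in_coboundaries[OF _ triv, rotated]) (fact down)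
  then obtain g where "f = coboundary X (k - 1) g"
    by (auto simp: coboundaries_def)
  then have "(\<Sum>S\<in>Pow I. f ((I - S) \<union> w ` S)) = 0"
    using sum_coboundary_cross_polytope[OF fin inj disj facet] by simp
  \<comment> \<open>A facet with \<open>S\<close> nonempty contains some \<open>w v\<close>, which
    lies outside \<open>I\<close>.\<close>
  moreover have "f ((I - S) \<union> w ` S) = of_bool (S = {})" if "S \<subseteq> I" for S
    using that disj by (auto simp: f_def)
  then have "(\<Sum>S\<in>Pow I. f ((I - S) \<union> w ` S)) = (\<Sum>S\<in>Pow I. of_bool (S = {}))"
    by (intro sum.cong) auto
  moreover have "(\<Sum>S\<in>Pow I. of_bool (S = {}) :: bit) = 1"
    using fin by (subst sum.remove[of _ "{}"]) auto
  ultimately show False by simp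
qed

section \<open>From the extension property to the inequality\<close>

text \<open>Induction on \<open>J\<close> chooses the opposite vertices one at a time. Each new one
  has to be adjacent to the other \<open>i\<close> vertices of \<open>I\<close> and to the at most
  \<open>i\<close> vertices chosen before; this is the source of the bound
  \<open>2 * i\<close>.\<close>

lemma common_extension_opposite_vertices:
  assumes simple: "simple_graph G" and ext: "common_extension (2 * i) G"
    and I: "I \<subseteq> verts G" "card I = Suc i" and "J \<subseteq> I"
  shows "\<exists>w. \<forall>v\<in>J. w v \<in> verts G - I \<and> {w v, v} \<notin> edges G \<and>
    (\<forall>u\<in>I - {v}. {w v, u} \<in> edges G) \<and> (\<forall>u\<in>J - {v}. {w v, w u} \<in> edges G)"
proof -
  have finI: "finite I" using I by (simp add: card_ge_0_finite)
  have "finite J" using \<open>J \<subseteq> I\<close> finI by (rule finite_subset)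
  then show ?thesis using \<open>J \<subseteq> I\<close>
  proof induction
    case (insert x J)
    then obtain w where w: "\<And>v. v \<in> J \<Longrightarrow> w v \<in> verts G - I \<and> {w v, v} \<notin> edges G \<and>
      (\<forall>u\<in>I - {v}. {w v, u} \<in> edges G) \<and> (\<forall>u\<in>J - {v}. {w v, w u} \<in> edges G)"
      by auto
    have x: "x \<in> I" "x \<notin> J" "J \<subseteq> I - {x}" using insert by auto
    define A where "A = (I - {x}) \<union> w ` J"
    have "card J \<le> i"
      using card_mono[OF _ x(3)] finI x(1) I by simp
    then have "card (w ` J) \<le> i"
      using card_image_le[OF insert.hyps(1), of w] by simp
    then have "card A \<le> 2 * i"
      using card_Un_le[of "I - {x}" "w ` J"] finI x(1) I by (simp add: A_def)
    moreover have "A \<subseteq> verts G" "x \<in> verts G - A"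
      using I w x by (auto simp: A_def)
    ultimately obtain y where y: "y \<in> verts G" "y \<noteq> x" "{y, x} \<notin> edges G"
      "\<forall>u\<in>A. {y, u} \<in> edges G"
      using ext unfolding common_extension_def by blast
    \<comment> \<open>A member of \<open>A\<close> adjacent to all of \<open>A\<close> would carry a
      loop.\<close>
    have "y \<notin> A" using y simple_graph_no_loop[OF simple] by auto
    then have "y \<notin> I" using y by (auto simp: A_def)
    define w' where "w' = w(x := y)"
    have "w' v \<in> verts G - I \<and> {w' v, v} \<notin> edges G \<and>
      (\<forall>u\<in>I - {v}. {w' v, u} \<in> edges G) \<and> (\<forall>u\<in>insert x J - {v}. {w' v, w' u} \<in> edges G)"
      if "v \<in> insert x J" for v
    proof (cases "v = x")
      case True
      then show ?thesis using y \<open>y \<notin> I\<close> x by (auto simp: w'_def A_def)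
    next
      case False
      then have "v \<in> J" using that by simp
      then have "{y, w v} \<in> edges G" using y by (simp add: A_def)
      then have "{w v, y} \<in> edges G" by (simp add: insert_commute)
      then show ?thesis using w[OF \<open>v \<in> J\<close>] False by (auto simp: w'_def)
    qed
    then show ?case by blast
  qed simp
qed

text \<open>For each \<open>I\<close> the common neighborhood itself is an admissible set to delete.
  The cross-polytope survives the deletion because \<open>w v\<close> is not adjacent to
  \<open>v\<close>.\<close>

lemma kappa_le_delta_if_common_extension:
  fixes G :: "'a::linorder sgraph"
  assumes simple: "simple_graph G" and ext: "common_extension (2 * i) G"
  shows "kappa TYPE(bit) i G \<le> delta i G"
  unfolding delta_def
proof (rule INF_greatest)
  fix I assume "I \<in> simplices (clique_complex G) (int i)"
  then have I: "I \<subseteq> verts G" "card I = Suc i" "finite I"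
    and adj: "\<And>u v. u \<in> I \<Longrightarrow> v \<in> I \<Longrightarrow> u \<noteq> v \<Longrightarrow> {u, v} \<in> edges G"
    by (auto simp: simplices_def clique_complex_def)
  obtain w where w: "\<And>v. v \<in> I \<Longrightarrow> w v \<in> verts G - I \<and> {w v, v} \<notin> edges G \<and>
    (\<forall>u\<in>I - {v}. {w v, u} \<in> edges G) \<and> (\<forall>u\<in>I - {v}. {w v, w u} \<in> edges G)"
    using common_extension_opposite_vertices[OF simple ext I(1,2) order_refl] by blast
  define C where "C = common_nbhd G I"
  define X where "X = clique_complex (delete_verts G C)"
  \<comment> \<open>For empty \<open>I\<close> the intersection defining \<open>common_nbhd\<close>
    would be \<open>UNIV\<close>, not a set of vertices.\<close>
  have "I \<noteq> {}" using I by auto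
  then have CV: "C \<subseteq> verts G"
    using simple_graph_edge_verts[OF simple] by (auto simp: C_def common_nbhd_def nbhd_def)
  have IC: "I \<inter> C = {}"
    using simple_graph_no_loop[OF simple] unfolding C_def common_nbhd_def nbhd_def by blast
  have wC: "w v \<notin> C" if "v \<in> I" for v
    using w[OF that] that by (auto simp: C_def common_nbhd_def nbhd_def)
  \<comment> \<open>Distinct opposite vertices are adjacent, so a coincidence would be a
    loop.\<close>
  have inj: "inj_on w I"
  proof (rule inj_onI, rule ccontr)
    fix u v assume "u \<in> I" "v \<in> I" "w u = w v" "u \<noteq> v"
    then have "{w u, w u} \<in> edges G" using w[of u] by (metis DiffI singletonD)
    with simple_graph_no_loop[OF simple] show False by blast
  qed
  have disj: "w ` I \<inter> I = {}" using w by auto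
  have X_iff: "\<sigma> \<in> X \<longleftrightarrow> finite \<sigma> \<and> \<sigma> \<subseteq> verts G - C \<and>
    (\<forall>u\<in>\<sigma>. \<forall>v\<in>\<sigma>. u \<noteq> v \<longrightarrow> {u, v} \<in> edges G)" for \<sigma>
    by (auto simp: X_def clique_complex_def delete_verts_def)
  have "\<not> trivial_group (reduced_cohomology X (int i) :: ('a set \<Rightarrow> bit) set monoid)"
  proof (rule nontrivial_reduced_cohomology_cross_polytope[OF _ I(3) inj disj])
    show "\<tau> \<in> X" if "\<sigma> \<in> X" "\<tau> \<subseteq> \<sigma>" for \<sigma> \<tau>
      using that clique_complex_down_closed unfolding X_def by blast
  next
    fix S assume S: "S \<subseteq> I"
    have "finite S" using S I(3) by (rule finite_subset)
    have "card ((I - S) \<union> w ` S) = card (I - S) + card (w ` S)"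
      using disj S I(3) \<open>finite S\<close> by (intro card_Un_disjoint) auto
    also have "card (w ` S) = card S"
      using inj S by (intro card_image) (rule inj_on_subset)
    also have "card (I - S) + card S = Suc i"
      using S I \<open>finite S\<close> card_mono[OF I(3) S] by (simp add: card_Diff_subset)
    finally have card: "card ((I - S) \<union> w ` S) = Suc i" .
    have "{u, v} \<in> edges G" if uv: "u \<in> (I - S) \<union> w ` S" "v \<in> (I - S) \<union> w ` S" "u \<noteq> v" for u v
    proof -
      have mixed: "{w a, b} \<in> edges G" if "a \<in> S" "b \<in> I - S" for a b
        using w[of a] that S by blast
      have "{w a, w b} \<in> edges G" if "a \<in> S" "b \<in> S" "w a \<noteq> w b" for a b
        using w[of a] that S by blast
      with mixed uv adj show ?thesis by (auto simp: insert_commute)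
    qed
    moreover have "(I - S) \<union> w ` S \<subseteq> verts G - C"
      using w wC I(1) IC S by blast
    ultimately show "(I - S) \<union> w ` S \<in> simplices X (int i)"
      using card I(3) \<open>finite S\<close> by (simp add: simplices_def X_iff)
  next
    fix \<sigma> assume \<sigma>: "\<sigma> \<in> X" "I \<subseteq> \<sigma>"
    \<comment> \<open>A further vertex of a simplex containing \<open>I\<close> is a common neighbor
      of \<open>I\<close>, hence has been deleted.\<close>
    have "u \<in> C" if "u \<in> \<sigma>" "u \<notin> I" for u
    proof -
      have "{u, c} \<in> edges G" if "c \<in> I" for c
      proof -
        have "c \<in> \<sigma>" "u \<noteq> c" using \<sigma>(2) that \<open>u \<notin> I\<close> by auto
        then show ?thesis using \<sigma>(1) \<open>u \<in> \<sigma>\<close> by (simp add: X_iff)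
      qed
      then show ?thesis by (simp add: C_def common_nbhd_def nbhd_def)
    qed
    with \<sigma> show "\<sigma> = I" by (auto simp: X_iff)
  qed
  then show "kappa TYPE(bit) i G \<le> enat (card (common_nbhd G I))"
    unfolding kappa_def using CV by (intro INF_lower) (simp add: X_def C_def)
qed

section \<open>Independence of events on disjoint coordinates\<close>

text \<open>Restricting to the supports makes both factors countable, so that
  \<open>measure_pmf_prob_product\<close> applies.\<close>

lemma measure_pmf_prob_pair_Times:
  "measure_pmf.prob (pair_pmf M N) (S \<times> T) = measure_pmf.prob M S * measure_pmf.prob N T"
proof -
  have "measure_pmf.prob (pair_pmf M N) (S \<times> T) =
      measure_pmf.prob (pair_pmf M N) ((S \<times> T) \<inter> set_pmf (pair_pmf M N))"
    by (simp only: measure_Int_set_pmf)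
  also have "(S \<times> T) \<inter> set_pmf (pair_pmf M N) = (S \<inter> set_pmf M) \<times> (T \<inter> set_pmf N)"
    by auto
  also have "measure_pmf.prob (pair_pmf M N) \<dots> =
      measure_pmf.prob M (S \<inter> set_pmf M) * measure_pmf.prob N (T \<inter> set_pmf N)"
    by (intro measure_pmf_prob_product) auto
  finally show ?thesis by (simp add: measure_Int_set_pmf)
qed

text \<open>A product distribution is sampled by drawing the coordinates in \<open>A\<close> and
  those in \<open>I - A\<close> independently; \<open>P\<close> sees only the first draw and
  \<open>Q\<close> only the second.\<close>

lemma prob_Pi_pmf_conj_disjoint:
  assumes fin: "finite I" and A: "A \<subseteq> I"
    and P: "\<And>f g. (\<And>x. x \<in> A \<Longrightarrow> f x = g x) \<Longrightarrow> P f = P g"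
    and Q: "\<And>f g. (\<And>x. x \<in> I - A \<Longrightarrow> f x = g x) \<Longrightarrow> Q f = Q g"
  shows "measure_pmf.prob (Pi_pmf I d p) {f. P f \<and> Q f} =
    measure_pmf.prob (Pi_pmf I d p) {f. P f} * measure_pmf.prob (Pi_pmf I d p) {f. Q f}"
proof -
  let ?M = "Pi_pmf A d p" and ?N = "Pi_pmf (I - A) d p"
  have I: "Pi_pmf I d p = map_pmf (\<lambda>(f, g) x. if x \<in> A then f x else g x) (pair_pmf ?M ?N)"
    using Pi_pmf_union[of A "I - A" d p] fin A by (simp add: finite_subset Un_absorb1)
  have P': "P (\<lambda>x. if x \<in> A then f x else g x) = P f" for f g
    by (rule P) simp
  have Q': "Q (\<lambda>x. if x \<in> A then f x else g x) = Q g" for f g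
    by (rule Q) simp
  have "measure_pmf.prob (Pi_pmf I d p) {f. P f \<and> Q f} =
      measure_pmf.prob (pair_pmf ?M ?N) ({f. P f} \<times> {g. Q g})"
    unfolding I measure_map_pmf
    by (rule arg_cong[where f = "measure_pmf.prob _"]) (auto simp: P' Q')
  moreover have "measure_pmf.prob (Pi_pmf I d p) {f. P f} =
      measure_pmf.prob (pair_pmf ?M ?N) ({f. P f} \<times> UNIV)"
    unfolding I measure_map_pmf
    by (rule arg_cong[where f = "measure_pmf.prob _"]) (auto simp: P')
  moreover have "measure_pmf.prob (Pi_pmf I d p) {f. Q f} =
      measure_pmf.prob (pair_pmf ?M ?N) (UNIV \<times> {g. Q g})"
    unfolding I measure_map_pmf
    by (rule arg_cong[where f = "measure_pmf.prob _"]) (auto simp: Q')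
  ultimately show ?thesis by (simp add: measure_pmf_prob_pair_Times)
qed

text \<open>Induction on \<open>W\<close>: the coordinates \<open>E v\<close> of a new index avoid
  those of all earlier ones, so its event splits off as a factor.\<close>

lemma prob_Pi_pmf_ball_disjoint:
  assumes "finite W" and fin: "finite I" and "\<And>w. w \<in> W \<Longrightarrow> E w \<subseteq> I"
    and "disjoint_family_on E W"
    and "\<And>w f g. w \<in> W \<Longrightarrow> (\<And>x. x \<in> E w \<Longrightarrow> f x = g x) \<Longrightarrow> P w f = P w g"
  shows "measure_pmf.prob (Pi_pmf I d p) {f. \<forall>w\<in>W. P w f} =
    (\<Prod>w\<in>W. measure_pmf.prob (Pi_pmf I d p) {f. P w f})"
  using assms(1,3-)
proof (induction W)
  case (insert v W)
  have "measure_pmf.prob (Pi_pmf I d p) {f. P v f \<and> (\<forall>w\<in>W. P w f)} =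
    measure_pmf.prob (Pi_pmf I d p) {f. P v f} *
    measure_pmf.prob (Pi_pmf I d p) {f. \<forall>w\<in>W. P w f}"
  proof (rule prob_Pi_pmf_conj_disjoint[OF fin])
    show "E v \<subseteq> I" using insert.prems by simp
    show "P v f = P v g" if "\<And>x. x \<in> E v \<Longrightarrow> f x = g x" for f g
      using insert.prems(3)[of v f g] that by simp
    show "(\<forall>w\<in>W. P w f) = (\<forall>w\<in>W. P w g)" if "\<And>x. x \<in> I - E v \<Longrightarrow> f x = g x" for f g
    proof (rule ball_cong[OF refl])
      fix w assume w: "w \<in> W"
      then have "E w \<inter> E v = {}" "E w \<subseteq> I"
        using insert.prems(1,2) insert.hyps(2) by (auto simp: disjoint_family_on_def)
      then show "P w f = P w g"
        using w by (intro insert.prems(3) that) auto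
    qed
  qed
  also have "measure_pmf.prob (Pi_pmf I d p) {f. \<forall>w\<in>W. P w f} =
      (\<Prod>w\<in>W. measure_pmf.prob (Pi_pmf I d p) {f. P w f})"
  proof (rule insert.IH)
    show "disjoint_family_on E W"
      using insert.prems(2) by (auto simp: disjoint_family_on_def)
    show "E w \<subseteq> I" if "w \<in> W" for w
      using insert.prems(1) that by simp
    show "P w f = P w g" if "w \<in> W" "\<And>x. x \<in> E w \<Longrightarrow> f x = g x" for w f g
      using that(1) by (intro insert.prems(3) that(2)) auto
  qed
  finally show ?case using insert.hyps by simp
qed simp

section \<open>Probability that the extension property fails\<close>

lemma finite_all_edges [simp]: "finite (all_edges n)"
  by (rule finite_subset[of _ "Pow {1..n}"]) (auto simp: all_edges_def)

lemma prob_common_extension_vertex: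
  assumes q: "0 \<le> q" "q \<le> 1" and A: "A \<subseteq> {1..n}" and v: "v \<in> {1..n} - A"
    and w: "w \<in> {1..n} - insert v A"
  shows "measure_pmf.prob (Pi_pmf (all_edges n) False (\<lambda>_. bernoulli_pmf q))
    {f. \<not> f {w, v} \<and> (\<forall>u\<in>A. f {w, u})} = q ^ card A * (1 - q)"
proof -
  let ?e = "\<lambda>u. {w, u}"
  \<comment> \<open>The event is a box: one edge is forced absent, those to \<open>A\<close> are
    forced present, and all others are free.\<close>
  define B where "B e = (if e = ?e v then {False} else if e \<in> ?e ` A then {True} else UNIV)" for e
  have inj: "inj_on ?e (insert v A)"
    by (auto simp: inj_on_def doubleton_eq_iff)
  have sub: "?e ` insert v A \<subseteq> all_edges n"
    using A v w by (auto simp: all_edges_def card_insert_if)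
  have eA: "?e u \<noteq> ?e v" if "u \<in> A" for u
    using that v by (auto simp: doubleton_eq_iff)
  have BA: "B (?e u) = {True}" if "u \<in> A" for u
    using that eA by (auto simp: B_def)
  have Bv: "B (?e v) = {False}" by (simp add: B_def)
  have "{f. \<not> f {w, v} \<and> (\<forall>u\<in>A. f {w, u})} = Pi (all_edges n) B"
  proof (intro equalityI subsetI)
    fix f assume "f \<in> {f. \<not> f {w, v} \<and> (\<forall>u\<in>A. f {w, u})}"
    then show "f \<in> Pi (all_edges n) B" by (auto simp: B_def)
  next
    fix f assume f: "f \<in> Pi (all_edges n) B"
    then have "f (?e u) \<in> B (?e u)" if "u \<in> insert v A" for u
      using sub that by blast
    then show "f \<in> {f. \<not> f {w, v} \<and> (\<forall>u\<in>A. f {w, u})}"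
      using BA Bv by auto
  qed
  then have "measure_pmf.prob (Pi_pmf (all_edges n) False (\<lambda>_. bernoulli_pmf q))
      {f. \<not> f {w, v} \<and> (\<forall>u\<in>A. f {w, u})} =
      (\<Prod>e\<in>all_edges n. measure_pmf.prob (bernoulli_pmf q) (B e))"
    by (simp add: measure_Pi_pmf_Pi)
  \<comment> \<open>Free edges contribute the factor 1.\<close>
  also have "\<dots> = (\<Prod>e\<in>?e ` insert v A. measure_pmf.prob (bernoulli_pmf q) (B e))"
    using sub by (intro prod.mono_neutral_right) (auto simp: B_def)
  also have "\<dots> = (\<Prod>u\<in>insert v A. measure_pmf.prob (bernoulli_pmf q) (B (?e u)))"
    using inj by (subst prod.reindex) simp_all
  also have "\<dots> = (1 - q) * (\<Prod>u\<in>A. q)"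
  proof -
    have "finite A" using A by (rule finite_subset) simp
    then show ?thesis using v q by (simp add: BA Bv measure_pmf_single)
  qed
  finally show ?thesis by simp
qed

lemma prob_no_common_extension_vertex:
  assumes q: "0 \<le> q" "q \<le> 1" and A: "A \<subseteq> {1..n}" and v: "v \<in> {1..n} - A"
  shows "measure_pmf.prob (Pi_pmf (all_edges n) False (\<lambda>_. bernoulli_pmf q))
    {f. \<forall>w\<in>{1..n} - insert v A. \<not> (\<not> f {w, v} \<and> (\<forall>u\<in>A. f {w, u}))} =
    (1 - q ^ card A * (1 - q)) ^ (n - Suc (card A))"
proof -
  let ?M = "Pi_pmf (all_edges n) False (\<lambda>_. bernoulli_pmf q)"
  define W where "W = {1..n} - insert v A"
  define P where "P w f \<longleftrightarrow> \<not> f {w, v} \<and> (\<forall>u\<in>A. f {w, u})" for w f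
  \<comment> \<open>The edges that decide whether \<open>w\<close> works. For distinct candidates
    they are disjoint: a shared edge would have both candidates as its ends, but its other end lies
    in \<open>insert v A\<close>, which contains no candidate.\<close>
  define E where "E w = (\<lambda>u. {w, u}) ` insert v A" for w
  have "finite A" using A by (rule finite_subset) simp
  have "measure_pmf.prob ?M {f. \<forall>w\<in>W. \<not> P w f} = (\<Prod>w\<in>W. measure_pmf.prob ?M {f. \<not> P w f})"
  proof (rule prob_Pi_pmf_ball_disjoint)
    show "E w \<subseteq> all_edges n" if "w \<in> W" for w
      using A v that by (auto simp: all_edges_def E_def W_def card_insert_if)
    show "disjoint_family_on E W"
      by (auto simp: disjoint_family_on_def E_def W_def doubleton_eq_iff)
    show "(\<not> P w f) = (\<not> P w g)" if "\<And>x. x \<in> E w \<Longrightarrow> f x = g x" for w f g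
      using that by (auto simp: P_def E_def)
  qed (simp_all add: W_def)
  also have "\<dots> = (\<Prod>w\<in>W. 1 - q ^ card A * (1 - q))"
  proof (rule prod.cong[OF refl])
    fix w assume "w \<in> W"
    then have "measure_pmf.prob ?M {f. P w f} = q ^ card A * (1 - q)"
      unfolding P_def W_def by (intro prob_common_extension_vertex q A v)
    moreover have "{f. \<not> P w f} = space (measure_pmf ?M) - {f. P w f}" by auto
    ultimately show "measure_pmf.prob ?M {f. \<not> P w f} = 1 - q ^ card A * (1 - q)"
      by (simp only: measure_pmf.prob_compl sets_measure_pmf UNIV_I)
  qed
  also have "card W = n - Suc (card A)"
    unfolding W_def using A v \<open>finite A\<close> by (subst card_Diff_subset) auto
  then have "(\<Prod>w\<in>W. 1 - q ^ card A * (1 - q)) = (1 - q ^ card A * (1 - q)) ^ (n - Suc (card A))"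
    by simp
  finally show ?thesis by (simp only: P_def W_def)
qed

text \<open>Every such subset is the range of a list of length at most \<open>k\<close>. As
  \<open>V\<close> is nonempty, the largest of the powers counting these lists is the last.\<close>

lemma card_subsets_card_le:
  assumes "finite V" "V \<noteq> {}"
  shows "card {A. A \<subseteq> V \<and> card A \<le> k} \<le> Suc k * card V ^ k"
proof -
  have fin: "finite {xs. set xs \<subseteq> V \<and> length xs \<le> k}"
    using assms(1) by (rule finite_lists_length_le)
  have "{A. A \<subseteq> V \<and> card A \<le> k} \<subseteq> set ` {xs. set xs \<subseteq> V \<and> length xs \<le> k}"
  proof
    fix A assume A: "A \<in> {A. A \<subseteq> V \<and> card A \<le> k}"
    then have "finite A" using assms(1) finite_subset by auto
    then obtain xs where "set xs = A" "distinct xs" using finite_distinct_list by blast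
    with A show "A \<in> set ` {xs. set xs \<subseteq> V \<and> length xs \<le> k}"
      by (auto simp: distinct_card)
  qed
  then have "card {A. A \<subseteq> V \<and> card A \<le> k} \<le> card {xs. set xs \<subseteq> V \<and> length xs \<le> k}"
    using fin by (rule surj_card_le[rotated])
  also have "\<dots> = (\<Sum>j\<le>k. card V ^ j)"
    using assms(1) by (rule card_lists_length_le)
  also have "\<dots> \<le> (\<Sum>j\<le>k. card V ^ k)"
    using assms by (intro sum_mono power_increasing) (auto simp: Suc_le_eq card_gt_0_iff)
  finally show ?thesis by simp
qed

text \<open>Union bound over the pairs \<open>(A, v)\<close> that could violate the
  property.\<close>

lemma prob_not_common_extension_le:
  assumes q: "0 \<le> q" "q \<le> 1" and n: "n \<ge> 1"
  shows "measure_pmf.prob (erdos_renyi n q) {G. \<not> common_extension k G} \<le>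
    real (Suc k) * real n ^ Suc k * (1 - q ^ k * (1 - q)) ^ (n - Suc k)"
proof -
  let ?M = "Pi_pmf (all_edges n) False (\<lambda>_. bernoulli_pmf q)"
  define \<A> where "\<A> = {A. A \<subseteq> {1..n} \<and> card A \<le> k}"
  define F where "F A v = {f. \<forall>w\<in>{1..n} - insert v A. \<not> (\<not> f {w, v} \<and> (\<forall>u\<in>A. f {w, u}))}"
    for A :: "nat set" and v :: nat
  define Z where "Z = (SIGMA A:\<A>. {1..n} - A)"
  have fin: "finite \<A>"
    by (rule finite_subset[of _ "Pow {1..n}"]) (auto simp: \<A>_def)
  then have finZ: "finite Z" by (simp add: Z_def)
  have edge: "{w, u} \<in> all_edges n" if "w \<in> {1..n}" "u \<in> {1..n}" "w \<noteq> u" for w u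
    using that by (auto simp: all_edges_def)
  have "measure_pmf.prob (erdos_renyi n q) {G. \<not> common_extension k G} =
      measure_pmf.prob ?M {f. \<not> common_extension k \<lparr>verts = {1..n}, edges = {e \<in> all_edges n. f e}\<rparr>}"
    by (simp add: erdos_renyi_def vimage_def)
  also have "\<dots> \<le> measure_pmf.prob ?M (\<Union>(A, v)\<in>Z. F A v)"
  proof (rule measure_pmf.finite_measure_mono, rule subsetI)
    fix f
    assume "f \<in> {f. \<not> common_extension k \<lparr>verts = {1..n}, edges = {e \<in> all_edges n. f e}\<rparr>}"
    then have "\<not> common_extension k \<lparr>verts = {1..n}, edges = {e \<in> all_edges n. f e}\<rparr>"
      by simp
    then obtain A v where Av: "A \<subseteq> {1..n}" "card A \<le> k" "v \<in> {1..n} - A"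
      and none: "\<And>w. w \<in> {1..n} \<Longrightarrow> w \<noteq> v \<Longrightarrow> {w, v} \<notin> {e \<in> all_edges n. f e} \<Longrightarrow>
        \<exists>u\<in>A. {w, u} \<notin> {e \<in> all_edges n. f e}"
      unfolding common_extension_def sgraph.simps by blast
    have "f \<in> F A v"
      unfolding F_def
    proof (intro CollectI ballI notI)
      fix w assume w: "w \<in> {1..n} - insert v A" and f: "\<not> f {w, v} \<and> (\<forall>u\<in>A. f {w, u})"
      then obtain u where "u \<in> A" "{w, u} \<notin> {e \<in> all_edges n. f e}"
        using none[of w] by auto
      \<comment> \<open>The missing pair is a possible edge, so its absence from the graph means
        that \<open>f\<close> is false there.\<close>
      moreover have "u \<in> {1..n}" "w \<noteq> u" using \<open>u \<in> A\<close> w Av by blast+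
      ultimately show False using edge[of w u] f w by blast
    qed
    moreover have "(A, v) \<in> Z" using Av by (simp add: Z_def \<A>_def)
    ultimately show "f \<in> (\<Union>(A, v)\<in>Z. F A v)" by blast
  qed simp
  also have "\<dots> \<le> (\<Sum>(A, v)\<in>Z. measure_pmf.prob ?M (F A v))"
    using measure_pmf.finite_measure_subadditive_finite[OF finZ, of "\<lambda>(A, v). F A v" ?M]
    by (simp add: case_prod_unfold)
  \<comment> \<open>The case \<open>card A = k\<close> is the worst: a smaller \<open>A\<close>
    leaves more candidates, and each of them is at least as likely to succeed.\<close>
  also have "\<dots> \<le> (\<Sum>(A, v)\<in>Z. (1 - q ^ k * (1 - q)) ^ (n - Suc k))"
  proof (rule sum_mono, clarify)
    fix A v assume "(A, v) \<in> Z"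
    then have Av: "A \<subseteq> {1..n}" "card A \<le> k" "v \<in> {1..n} - A"
      by (auto simp: Z_def \<A>_def)
    have le1: "q ^ j * (1 - q) \<le> 1" for j
      using q by (intro mult_le_one power_le_one) auto
    have "measure_pmf.prob ?M (F A v) = (1 - q ^ card A * (1 - q)) ^ (n - Suc (card A))"
      unfolding F_def using q Av by (intro prob_no_common_extension_vertex)
    also have "\<dots> \<le> (1 - q ^ card A * (1 - q)) ^ (n - Suc k)"
      using Av q le1 by (intro power_decreasing) auto
    also have "\<dots> \<le> (1 - q ^ k * (1 - q)) ^ (n - Suc k)"
      using Av q le1 by (intro power_mono diff_left_mono mult_right_mono power_decreasing) auto
    finally show "measure_pmf.prob ?M (F A v) \<le> (1 - q ^ k * (1 - q)) ^ (n - Suc k)" .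
  qed
  also have "\<dots> = real (card Z) * (1 - q ^ k * (1 - q)) ^ (n - Suc k)"
    by simp
  also have "\<dots> \<le> real (Suc k) * real n ^ Suc k * (1 - q ^ k * (1 - q)) ^ (n - Suc k)"
  proof (rule mult_right_mono)
    have "card Z \<le> card (\<A> \<times> {1..n})"
      using fin by (intro card_mono) (auto simp: Z_def)
    also have "\<dots> = card \<A> * n" by (simp add: card_cartesian_product)
    also have "\<dots> \<le> Suc k * n ^ k * n"
      using card_subsets_card_le[of "{1..n}" k] n unfolding \<A>_def by (intro mult_right_mono) auto
    also have "\<dots> = Suc k * n ^ Suc k" by (simp only: power_Suc2 mult.assoc)
    finally have "real (card Z) \<le> real (Suc k * n ^ Suc k)" by (rule of_nat_mono)
    then show "real (card Z) \<le> real (Suc k) * real n ^ Suc k"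
      by (simp only: of_nat_mult of_nat_power)
    show "0 \<le> (1 - q ^ k * (1 - q)) ^ (n - Suc k)"
      using q by (simp add: mult_le_one power_le_one)
  qed
  finally show ?thesis .
qed

section \<open>Asymptotics\<close>

text \<open>The strict inequality in \<open>middling\<close> leaves room for an exponent
  \<open>c > - 1 / k\<close> with \<open>p n\<close> eventually at least \<open>n powr c\<close>.
  Then \<open>b = 1 + c * k\<close> is positive.\<close>

lemma middling_powr_lower_bound:
  assumes "middling (real k) p" and nonneg: "eventually (\<lambda>n. 0 \<le> p n) sequentially"
  obtains b where "0 < b" and "eventually (\<lambda>n. real n powr (b - 1) \<le> p n ^ k) sequentially"
proof (cases "k = 0")
  case True
  show ?thesis
  \<comment> \<open>Here \<open>p n ^ k = 1\<close>, so \<open>b = 1\<close> suffices whatever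
    \<open>p\<close> is.\<close>
  proof (rule that[of 1])
    show "eventually (\<lambda>n. real n powr (1 - 1) \<le> p n ^ k) sequentially"
      using True by simp
  qed simp
next
  case False
  have "- liminf (\<lambda>n. elog (real n) (p n)) < ereal (1 / real k)"
    using assms False by (simp add: middling_def inverse_eq_divide)
  then have "ereal (- 1 / real k) < liminf (\<lambda>n. elog (real n) (p n))"
    by (metis ereal_minus_less_minus ereal_uminus_uminus minus_divide_left uminus_ereal.simps(1))
  then obtain c where c: "- 1 / real k < c" "ereal c < liminf (\<lambda>n. elog (real n) (p n))"
    using ereal_dense2 by (metis less_ereal.simps(1))
  have ev: "eventually (\<lambda>n. ereal c < elog (real n) (p n)) sequentially"
    using c(2) by (rule less_LiminfD)
  show ?thesis
  proof (rule that[of "1 + c * real k"])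
    show "0 < 1 + c * real k"
      using c(1) False by (simp add: field_simps)
    show "eventually (\<lambda>n. real n powr (1 + c * real k - 1) \<le> p n ^ k) sequentially"
      using ev nonneg eventually_gt_at_top[of 1]
    proof eventually_elim
      case (elim n)
      then have pn: "0 < p n" "c < log (real n) (p n)"
        \<comment> \<open>\<open>elog\<close> is \<open>- \<infinity>\<close> at 0, so the lower
          bound \<open>c\<close> excludes \<open>p n = 0\<close>.\<close>
        by (auto simp: elog_def split: if_splits)
      then have "real n powr c \<le> p n"
        using elim by (simp add: less_log_iff)
      then have "(real n powr c) ^ k \<le> p n ^ k"
        by (rule power_mono) simp
      then show ?case
        using elim by (simp add: powr_power mult.commute)
    qed
  qed
qed

lemma tendsto_poly_exp_powr:
  assumes "0 < (b::real)"
  shows "(\<lambda>n. real (Suc k) * real n ^ Suc k * exp (- (real n powr b) / 4)) \<longlonglongrightarrow> 0"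
  using assms by real_asymp

section \<open>The limit\<close>

theorem proposition1p5:
  fixes i :: nat and p :: "nat \<Rightarrow> real"
  assumes "\<And>n. n \<ge> 1 \<Longrightarrow> 0 \<le> p n \<and> p n \<le> 1"
    and "middling (2 * real i) p"
  shows "(\<lambda>n. measure_pmf.prob (erdos_renyi n (p n)) {G. kappa TYPE(bit) i G \<le> delta i G})
           \<longlonglongrightarrow> 1"
proof -
  define k where "k = 2 * i"
  define good where "good n = measure_pmf.prob (erdos_renyi n (p n)) {G. common_extension k G}" for n
  define bound where "bound b n = real (Suc k) * real n ^ Suc k * exp (- (real n powr b) / 4)" for b n
  have "eventually (\<lambda>n. 0 \<le> p n) sequentially"
    using eventually_ge_at_top[of 1] by eventually_elim (use assms(1) in auto)
  moreover have "middling (real k) p" using assms(2) by (simp add: k_def)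
  ultimately obtain b where b: "0 < b"
    and pk: "eventually (\<lambda>n. real n powr (b - 1) \<le> p n ^ k) sequentially"
    using middling_powr_lower_bound by blast
  have "eventually (\<lambda>n. p n < 1 / 2) sequentially"
    using assms(2) by (intro order_tendstoD) (auto simp: middling_def)
  with pk have lower: "eventually (\<lambda>n. 1 - bound b n \<le> good n) sequentially"
    using eventually_ge_at_top[of "2 * Suc k"]
  proof eventually_elim
    case (elim n)
    then have n: "n \<ge> 1" and p: "0 \<le> p n" "p n \<le> 1" using assms(1)[of n] by auto
    let ?x = "p n ^ k * (1 - p n)"
    \<comment> \<open>The 4 is a product of two halves: \<open>n - Suc k\<close> is at least
      \<open>n / 2\<close> once \<open>n \<ge> 2 * Suc k\<close>, and \<open>1 - p n\<close> exceeds
      1/2.\<close>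
    have "real n powr b / 4 = (real n / 2) * (real n powr (b - 1) * (1 / 2))"
      using n by (simp add: powr_diff)
    also have "\<dots> \<le> real (n - Suc k) * ?x"
      using elim p by (intro mult_mono) auto
    finally have "real n powr b / 4 \<le> real (n - Suc k) * ?x" .
    have "?x \<le> 1" using p by (intro mult_le_one power_le_one) auto
    then have "(1 - ?x) ^ (n - Suc k) \<le> exp (- ?x) ^ (n - Suc k)"
      by (intro power_mono exp_minus_ge) auto
    also have "\<dots> = exp (- (real (n - Suc k) * ?x))"
      by (simp flip: exp_of_nat_mult)
    also have "\<dots> \<le> exp (- (real n powr b) / 4)"
      using \<open>real n powr b / 4 \<le> _\<close> by simp
    finally have "real (Suc k) * real n ^ Suc k * (1 - ?x) ^ (n - Suc k) \<le> bound b n"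
      unfolding bound_def by (intro mult_left_mono) auto
    with prob_not_common_extension_le[OF p n, of k]
    have "measure_pmf.prob (erdos_renyi n (p n)) {G. \<not> common_extension k G} \<le> bound b n"
      by linarith
    then show ?case
      using measure_pmf.prob_neg[of "erdos_renyi n (p n)" "common_extension k"]
      by (simp add: good_def)
  qed
  \<comment> \<open>The deterministic inequality needs a simple graph, so the event is first
    restricted to the support of the distribution.\<close>
  have good_le: "good n \<le> measure_pmf.prob (erdos_renyi n (p n))
      {G. kappa TYPE(bit) i G \<le> delta i G}" for n
  proof -
    have "good n = measure_pmf.prob (erdos_renyi n (p n))
        ({G. common_extension k G} \<inter> set_pmf (erdos_renyi n (p n)))"
      by (simp add: good_def measure_Int_set_pmf)
    also have "\<dots> \<le> measure_pmf.prob (erdos_renyi n (p n)) {G. kappa TYPE(bit) i G \<le> delta i G}"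
    proof (rule measure_pmf.finite_measure_mono, rule subsetI)
      fix G assume "G \<in> {G. common_extension k G} \<inter> set_pmf (erdos_renyi n (p n))"
      then show "G \<in> {G. kappa TYPE(bit) i G \<le> delta i G}"
        using kappa_le_delta_if_common_extension[of G i] erdos_renyi_simple[of G n "p n"]
        by (simp add: k_def)
    qed simp
    finally show ?thesis .
  qed
  show ?thesis
  proof (rule tendsto_sandwich[of "\<lambda>n. 1 - bound b n" _ _ "\<lambda>_. 1"])
    show "eventually (\<lambda>n. 1 - bound b n \<le> measure_pmf.prob (erdos_renyi n (p n))
        {G. kappa TYPE(bit) i G \<le> delta i G}) sequentially"
      using lower by eventually_elim (rule order_trans[OF _ good_le])
    show "(\<lambda>n. 1 - bound b n) \<longlonglongrightarrow> 1"
      using tendsto_diff[OF tendsto_const[of 1] tendsto_poly_exp_powr[OF b, of k]]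
      by (simp add: bound_def)
  qed simp_all
qed

end
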